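(* Let $n\ge 2$ be an integer and $D=11\times(10^{n}-1)$. Then there exist Ball magic numbers $B_1$ and $B_2$ such that $D=B_1+B_2$.
   Context: Ball magic number: let $N\ge 2$ and let $x$ be a positive integer with exactly $N$ decimal digits, $x=a_{N-1}\dots a_0$ with $a_{N-1}\neq 0$, which is not a palindrome. Its reverse $x'$ is the integer with digit string $a_0a_1\dots a_{N-1}$ (leading zeros allowed). Let $y=|x-x'|$, written as an $N$-digit string $b_{N-1}\dots b_0$ (leading zeros allowed), and let $y'$ be the integer with digit string $b_0\dots b_{N-1}$. The nonzero integer $B=y+y'$ is a Ball magic number; a Ball magic number is any integer obtained this way from some such $x$. *)

theory Defs
  imports Main
begin

text \<open>
  Digit strings are lists written in the usual order, most significant digit first; leading
  zeros are allowed. The library's \<^const>\<open>horner_sum\<close> reads the least significant entry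
  first, hence the reversal.
\<close>

definition digit_string :: "nat \<Rightarrow> nat list \<Rightarrow> bool" where
  "digit_string N ds \<longleftrightarrow> length ds = N \<and> (\<forall>d\<in>set ds. d < 10)"

definition decimal_value :: "nat list \<Rightarrow> int" where
  "decimal_value ds = horner_sum int 10 (rev ds)"

text \<open>
  Here \<open>as\<close> is the digit string of \<open>x\<close>, and \<open>bs\<close> is that of \<open>y = \<bar>x - x'\<bar>\<close>, padded with
  leading zeros to the same length \<open>N\<close>. The resulting \<open>B\<close> is automatically nonzero, because
  \<open>as\<close> is not a palindrome.
\<close>

definition ball_magic_number :: "int \<Rightarrow> bool" where
  "ball_magic_number B \<longleftrightarrow>
    (\<exists>N as bs. N \<ge> 2 \<and>
      digit_string N as \<and> hd as \<noteq> 0 \<and> rev as \<noteq> as \<and>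
      digit_string N bs \<and>
      decimal_value bs = \<bar>decimal_value as - decimal_value (rev as)\<bar> \<and>
      B = decimal_value bs + decimal_value (rev bs))"

end

theory Submission
  imports Defs
begin

text \<open>
  Write \<open>D = 99 + 11 * (10 ^ n - 10)\<close>. Every two-digit non-palindrome yields \<open>99\<close>. The
  \<open>(n + 2)\<close>-digit number \<open>x = 110\<dots>01\<close> satisfies \<open>x - x' = 10 ^ n - 10\<close>, whose padded digit
  string \<open>009\<dots>90\<close> has a reverse that is ten times as large, so \<open>x\<close> yields the other summand.
\<close>

lemma decimal_value_Nil [simp]: "decimal_value [] = 0"
  by (simp add: decimal_value_def)

lemma decimal_value_Cons [simp]:
  "decimal_value (d # ds) = int d * 10 ^ length ds + decimal_value ds"
  by (simp add: decimal_value_def horner_sum_append)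

lemma decimal_value_append [simp]:
  "decimal_value (ds @ es) = decimal_value ds * 10 ^ length es + decimal_value es"
  by (induction ds) (simp_all add: power_add algebra_simps)

lemma decimal_value_replicate_0 [simp]: "decimal_value (replicate m 0) = 0"
  by (induction m) simp_all

lemma decimal_value_replicate_9 [simp]: "decimal_value (replicate m 9) = 10 ^ m - 1"
  by (induction m) simp_all

text \<open>A positive difference serves twice: it removes the absolute value and excludes
  palindromes, for which the difference is \<open>0\<close>.\<close>

lemma ball_magic_numberI:
  assumes "N \<ge> 2" "digit_string N as" "hd as \<noteq> 0" "digit_string N bs"
    and "decimal_value bs = decimal_value as - decimal_value (rev as)"
    and "decimal_value bs > 0"
    and "B = decimal_value bs + decimal_value (rev bs)"
  shows "ball_magic_number B"
proof -
  have "rev as \<noteq> as"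
    using assms(5,6) by auto
  then show ?thesis
    unfolding ball_magic_number_def using assms by (intro exI[of _ N] exI[of _ as] exI[of _ bs]) auto
qed

lemma ball_magic_number_99: "ball_magic_number 99"
  \<comment> \<open>10 - 01 = 09 and 09 + 90 = 99.\<close>
  by (rule ball_magic_numberI[where N = 2 and as = "[1, 0]" and bs = "[0, 9]"])
    (simp_all add: digit_string_def)

lemma ball_magic_number_11_times:
  assumes "n \<ge> 2"
  shows "ball_magic_number (11 * (10 ^ n - 10))"
proof -
  \<comment> \<open>\<open>10 ^ n - 10 = 10 * (10 ^ m - 1)\<close> has exactly \<open>m\<close>
    nines.\<close>
  obtain m where n: "n = Suc m" and m: "m > 0"
    using assms by (cases n) auto
  \<comment> \<open>This makes the difference positive; at \<open>m = 0\<close> the string would be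
    the palindrome 111.\<close>
  have "(10 :: int) ^ m > 1"
    using m by (simp add: one_less_power)
  then show ?thesis
    by (intro ball_magic_numberI[where N = "m + 3"
          and as = "1 # 1 # replicate m 0 @ [1]" and bs = "0 # 0 # replicate m 9 @ [0]"])
      (auto simp: digit_string_def n algebra_simps)
qed

theorem theorem21:
  fixes n :: nat and D :: int
  assumes "n \<ge> 2" and "D = 11 * (10 ^ n - 1)"
  shows "\<exists>B\<^sub>1 B\<^sub>2. ball_magic_number B\<^sub>1 \<and> ball_magic_number B\<^sub>2 \<and> D = B\<^sub>1 + B\<^sub>2"
proof (intro exI conjI)
  show "ball_magic_number 99"
    by (rule ball_magic_number_99)
  show "ball_magic_number (11 * (10 ^ n - 10))"
    using assms(1) by (rule ball_magic_number_11_times)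
  show "D = 99 + 11 * (10 ^ n - 10)"
    using assms(2) by simp
qed

end
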